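(* Let $$R=\{2^3,\,2^5,\,3\cdot2^6\},$$ $$S=\left\{\left(3\cdot2^j,\tfrac{1+\delta}{2}\right):2\le j\le5\right\}\cup\left\{(2^4,-\delta),\,(2^6,-\delta)\right\},$$ $$A=\left\{\left(3,\tfrac14\right),\left(3^2,\tfrac14\right)\right\}.$$ Then $(R,S,A)$ is a local uniform rule of gain $1$.
   Context: For $x\in\mathbb R$ (or $x\in\mathbb R/\mathbb Z$), $\lVert x\rVert$ denotes the distance from $x$ to the closest integer. A configuration is a finite set of runners with distinct positive integer velocities $v_i$ and initial shifts $s_i\in\mathbb R/\mathbb Z$; the runner with velocity $v_i$ and shift $s_i$ is at position $s_i+v_it\in\mathbb R/\mathbb Z$ at time $t\in\mathbb R/\mathbb Z$. For $\delta>0$, a configuration is a $\delta$-cover if for every $t$ some runner satisfies $\lVert s_i+v_it\rVert\le\delta$. Uniform rule. A uniform rule $(R,S,A)$ consists of: a finite set $R=\{r_i\}$ of even positive integer velocities to remove; a finite set $S=\{(s_i,\alpha_i+\beta_i\delta)\}$ of even positive integer velocities $s_i$ to rephase, with new shifts $\alpha_i+\beta_i\delta$; and a finite set $A=\{(a_i,\gamma_i+\eta_i\delta)\}$ of odd positive integer velocities $a_i$ to add, with shifts $\gamma_i+\eta_i\delta$. Here $\alpha_i,\beta_i,\gamma_i,\eta_i$ are real constants and $\delta$ is a formal parameter; the velocities $r_i,s_i$ are pairwise distinct and the velocities $a_i$ are pairwise distinct. For a positive integer $N$, the starting configuration consists of the $N$ runners with velocities $2,4,\ldots,2N$, all with shift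 $0$. An odd positive integer $b$ is admissible for $N$ if all velocities $r_ib$ and $s_ib$ occur in the starting configuration. It is required that, for every $N$ and every admissible $b$, with $\delta=1/(N+1)$, removing the runners with velocities $r_ib$, changing the shifts of the runners with velocities $s_ib$ to $\alpha_i+\beta_i\delta$, and adding runners with velocities $a_ib$ and shifts $\gamma_i+\eta_i\delta$ leaves a $\delta$-cover. This is called applying the rule at scale $b$. The gain of a uniform rule is $|R|-|A|$. Local. In the starting configuration with velocities $2,4,\ldots,2N$ and zero shifts, and with $\delta=1/(N+1)$, the runner with velocity $q$ is responsible for a time $t$ if $q$ is the smallest velocity in $\{2,4,\ldots,2N\}$ satisfying $\lVert qt\rVert\le\delta$. A uniform rule is local if, for every $N$, every admissible odd $b$, and every time $t$, whenever a runner removed or rephased by the rule at scale $b$ (velocity $r_ib$ or $s_ib$) is responsible for $t$, some runner rephased or added by the same application of the rule (velocity $s_ib$ with shift $\alpha_i+\beta_i\delta$, or velocity $a_ib$ with shift $\gamma_i+\eta_i\delta$) is within distance $\delta$ of the origin at time $t$. *)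

theory Defs
  imports "HOL-Analysis.Analysis"
begin

definition dist_nint :: "real \<Rightarrow> real" where
  "dist_nint x = \<bar>x - of_int (round x)\<bar>"

lemma dist_nint_eq_infdist: "dist_nint x = infdist x \<int>"
proof (rule antisym)
  have "dist_nint x \<le> dist x y" if "y \<in> \<int>" for y
    using that round_diff_minimal[of x]
    by (auto simp: dist_nint_def dist_real_def elim!: Ints_cases)
  then show "dist_nint x \<le> infdist x \<int>"
    by (auto simp: infdist_def intro!: cINF_greatest Ints_0)
  show "infdist x \<int> \<le> dist_nint x"
    using infdist_le[of "of_int (round x)" "\<int>" x]
    by (simp add: dist_nint_def dist_real_def)
qed

(* Hence reals can serve as representatives of times and shifts in R/Z. *)
lemma dist_nint_add_int: "dist_nint (x + of_int k) = dist_nint x"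
proof -
  have "x + of_int k + 1/2 = (x + 1/2) + of_int k"
    by simp
  then have "round (x + of_int k) = round x + k"
    unfolding round_def by (metis floor_add_int)
  then show ?thesis by (simp add: dist_nint_def)
qed

text \<open>A runner is a pair of a velocity and a real representative of its shift modulo 1.\<close>

type_synonym runner = "nat \<times> real"

definition position :: "runner \<Rightarrow> real \<Rightarrow> real" where
  "position p t = snd p + real (fst p) * t"

definition configuration :: "runner set \<Rightarrow> bool" where
  "configuration C \<longleftrightarrow> finite C \<and> inj_on fst C \<and> (\<forall>p\<in>C. 0 < fst p)"

definition delta_cover :: "real \<Rightarrow> runner set \<Rightarrow> bool" where
  "delta_cover \<delta> C \<longleftrightarrow> 0 < \<delta> \<and> configuration C \<and>
     (\<forall>t. \<exists>p\<in>C. dist_nint (position p t) \<le> \<delta>)"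

definition start_velocities :: "nat \<Rightarrow> nat set" where
  "start_velocities N = (\<lambda>k. 2 * k) ` {1..N}"

definition start_config :: "nat \<Rightarrow> runner set" where
  "start_config N = (\<lambda>q. (q, 0)) ` start_velocities N"

definition delta :: "nat \<Rightarrow> real" where
  "delta N = 1 / (real N + 1)"

text \<open>
  The triple \<open>(v, \<alpha>, \<beta>)\<close> stands for a velocity \<open>v\<close> with shift \<open>\<alpha> + \<beta> * \<delta>\<close>, where \<open>\<delta>\<close> is a
  formal parameter.
\<close>

type_synonym formal_runner = "nat \<times> real \<times> real"

definition scaled_runner :: "nat \<Rightarrow> real \<Rightarrow> formal_runner \<Rightarrow> runner" where
  "scaled_runner b \<delta> = (\<lambda>(v, \<alpha>, \<beta>). (v * b, \<alpha> + \<beta> * \<delta>))"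

definition rule_data ::
  "nat set \<Rightarrow> formal_runner set \<Rightarrow> formal_runner set \<Rightarrow> bool" where
  "rule_data R S A \<longleftrightarrow>
     finite R \<and> finite S \<and> finite A \<and>
     (\<forall>r\<in>R. 0 < r \<and> even r) \<and>
     (\<forall>p\<in>S. 0 < fst p \<and> even (fst p)) \<and>
     (\<forall>p\<in>A. 0 < fst p \<and> odd (fst p)) \<and>
     inj_on fst S \<and> R \<inter> fst ` S = {} \<and> inj_on fst A"

definition affected :: "nat set \<Rightarrow> formal_runner set \<Rightarrow> nat \<Rightarrow> nat set" where
  "affected R S b = (\<lambda>v. v * b) ` (R \<union> fst ` S)"

definition admissible ::
  "nat set \<Rightarrow> formal_runner set \<Rightarrow> nat \<Rightarrow> nat \<Rightarrow> bool" where
  "admissible R S N b \<longleftrightarrow> 0 < b \<and> odd b \<and> affected R S b \<subseteq> start_velocities N"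

definition apply_rule ::
  "nat set \<Rightarrow> formal_runner set \<Rightarrow> formal_runner set \<Rightarrow> nat \<Rightarrow> nat \<Rightarrow> runner set" where
  "apply_rule R S A N b =
     {p \<in> start_config N. fst p \<notin> affected R S b} \<union>
     scaled_runner b (delta N) ` S \<union> scaled_runner b (delta N) ` A"

definition uniform_rule ::
  "nat set \<Rightarrow> formal_runner set \<Rightarrow> formal_runner set \<Rightarrow> bool" where
  "uniform_rule R S A \<longleftrightarrow> rule_data R S A \<and>
     (\<forall>N b. 0 < N \<and> admissible R S N b \<longrightarrow> delta_cover (delta N) (apply_rule R S A N b))"

definition gain :: "nat set \<Rightarrow> formal_runner set \<Rightarrow> int" where
  "gain R A = int (card R) - int (card A)"

definition responsible :: "nat \<Rightarrow> nat \<Rightarrow> real \<Rightarrow> bool" where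
  "responsible N q t \<longleftrightarrow>
     q \<in> start_velocities N \<and> dist_nint (real q * t) \<le> delta N \<and>
     (\<forall>q'\<in>start_velocities N. dist_nint (real q' * t) \<le> delta N \<longrightarrow> q \<le> q')"

definition local_rule ::
  "nat set \<Rightarrow> formal_runner set \<Rightarrow> formal_runner set \<Rightarrow> bool" where
  "local_rule R S A \<longleftrightarrow> uniform_rule R S A \<and>
     (\<forall>N b t. 0 < N \<and> admissible R S N b \<and> (\<exists>q\<in>affected R S b. responsible N q t) \<longrightarrow>
       (\<exists>p\<in>S \<union> A. dist_nint (position (scaled_runner b (delta N) p) t) \<le> delta N))"

end

theory Submission
  imports Defs
begin

text \<open>
  By Dirichlet's approximation theorem the starting configuration is a \<open>\<delta>\<close>-cover, so every time
  has a responsible runner. If that runner is not affected by the rule, it still covers the time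
  afterwards. Hence well-formed rule data give a uniform local rule once the locality condition
  holds (\<open>local_ruleI\<close>), and everything reduces to the times for which an affected
  runner is responsible.

  Let the runner of velocity \<open>v b\<close> be responsible for \<open>t\<close>, put \<open>x = b t\<close>, and write
  \<open>v x = p + e\<close> with \<open>p\<close> an integer and \<open>\<bar>e\<bar> \<le> \<delta>\<close>. All affected \<open>v\<close> are divisible by \<open>4\<close>, so the
  runner of velocity \<open>(v / 2) b\<close> is also in the starting configuration; were \<open>p\<close> even, it
  would be within \<open>\<delta> / 2\<close> of the origin and minimality would fail. So \<open>p\<close> is odd
  (\<open>responsible_nearest_int_odd\<close>), and for each \<open>v\<close> some new runner takes over; positions are
  taken modulo \<open>1\<close>:

    \<^item> For \<open>v = 24, 48, 96, 192\<close> the runner of velocity \<open>v / 2\<close> with shift \<open>(1 + \<delta>) / 2\<close> is at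
      \<open>(1 + p) / 2 + (e + \<delta>) / 2\<close>, and the first summand is an integer
      (\<open>half_velocity_covers\<close>).
    \<^item> For \<open>v = 8, 16, 32, 64\<close> the sign of \<open>e\<close> decides. If \<open>e \<ge> 0\<close>, a runner of velocity \<open>v\<close> or
      \<open>2 v\<close> with shift \<open>- \<delta>\<close> is at \<open>e - \<delta>\<close> or \<open>2 e - \<delta>\<close>. If \<open>e < 0\<close>, the runner of velocity
      \<open>3 v / 2\<close> with shift \<open>(1 + \<delta>) / 2\<close> is at \<open>(3 e + \<delta>) / 2\<close>, which lies between \<open>- \<delta>\<close> and
      \<open>\<delta> / 2\<close> (\<open>sign_of_error_covers\<close>).
    \<^item> For \<open>v = 12\<close> the added runners are at \<open>(p + 1) / 4 + e / 4\<close> and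
      \<open>(3 p + 1) / 4 + 3 e / 4\<close>; one of \<open>p + 1\<close> and \<open>3 p + 1\<close> is divisible by \<open>4\<close>
      (\<open>quarter_shifts_cover\<close>).
\<close>

lemma dist_nint_le_iff: "dist_nint x \<le> d \<longleftrightarrow> (\<exists>k::int. \<bar>x - of_int k\<bar> \<le> d)"
  unfolding dist_nint_def using round_diff_minimal[of x] order_trans by blast

lemma dist_nint_le_of_near_int: "\<bar>x - of_int k\<bar> \<le> d \<Longrightarrow> dist_nint x \<le> d"
  by (auto simp: dist_nint_le_iff)

text \<open>
  The sharp bound \<open>1 / (N + 1)\<close> comes from a pigeonhole on \<open>N - 1\<close> boxes: if no multiple were within
  \<open>1 / (N + 1)\<close> of an integer, the fractional parts of all \<open>N\<close> multiples would avoid the two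
  outermost of the \<open>N + 1\<close> boxes of length \<open>1 / (N + 1)\<close>. Two of them would share a box, and their
  difference is again one of the multiples, up to an integer.
\<close>

lemma dirichlet_sharp:
  assumes "0 < N"
  shows "\<exists>k\<in>{1..N}. dist_nint (real k * x) \<le> delta N"
proof (rule ccontr)
  assume "\<not> ?thesis"
  then have far: "delta N < \<bar>real k * x - of_int m\<bar>" if "k \<in> {1..N}" for k and m :: int
    using that by (meson dist_nint_le_iff not_less)
  define M where "M = real N + 1"
  have M: "M > 0" "delta N = 1 / M" by (auto simp: M_def delta_def)
  define box where "box k = \<lfloor>M * frac (real k * x)\<rfloor>" for k :: nat
  have box_range: "box k \<in> {1..int N - 1}" if k: "k \<in> {1..N}" for k
  proof -
    let ?f = "frac (real k * x)"
    have f: "0 \<le> ?f" "?f < 1" by (auto simp: frac_lt_1)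
    have "1 / M < ?f"
      using far[OF k, of "\<lfloor>real k * x\<rfloor>"] f(1) M by (simp add: frac_def)
    moreover have "1 / M < 1 - ?f"
      using far[OF k, of "\<lfloor>real k * x\<rfloor> + 1"] f(2) M by (simp add: frac_def)
    ultimately have "1 < M * ?f" "M * ?f < M - 1"
      using M(1) by (auto simp: field_simps)
    then have "1 \<le> box k" "box k < int N"
      unfolding box_def M_def by (auto simp: le_floor_iff floor_less_iff)
    then show ?thesis by simp
  qed
  have "card (box ` {1..N}) \<le> card {1..int N - 1}"
    by (rule card_mono) (use box_range in auto)
  also have "\<dots> < card {1..N}" using assms by simp
  finally have "\<not> inj_on box {1..N}" by (rule pigeonhole)
  then obtain i j where ij: "i \<in> {1..N}" "j \<in> {1..N}" "i < j" "box i = box j"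
    by (metis (no_types, lifting) inj_on_def linorder_neqE_nat)
  have "\<bar>M * frac (real j * x) - M * frac (real i * x)\<bar> < 1"
    using ij(4) unfolding box_def by linarith
  then have "M * \<bar>frac (real j * x) - frac (real i * x)\<bar> < 1"
    using M(1) by (simp add: abs_mult flip: right_diff_distrib)
  then have "\<bar>frac (real j * x) - frac (real i * x)\<bar> < delta N"
    using M by (simp add: pos_less_divide_eq mult.commute)
  moreover have "frac (real j * x) - frac (real i * x)
      = real (j - i) * x - of_int (\<lfloor>real j * x\<rfloor> - \<lfloor>real i * x\<rfloor>)"
    using ij(3) by (simp add: frac_def of_nat_diff algebra_simps)
  moreover have "j - i \<in> {1..N}" using ij by auto
  ultimately show False
    using far[of "j - i" "\<lfloor>real j * x\<rfloor> - \<lfloor>real i * x\<rfloor>"] by auto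
qed

lemma ex_responsible:
  assumes "0 < N"
  shows "\<exists>q. responsible N q t"
proof -
  let ?P = "\<lambda>q. q \<in> start_velocities N \<and> dist_nint (real q * t) \<le> delta N"
  obtain k where k: "k \<in> {1..N}" "dist_nint (real k * (2 * t)) \<le> delta N"
    using dirichlet_sharp[OF assms, of "2 * t"] by blast
  then have "?P (2 * k)" by (auto simp: start_velocities_def mult_ac)
  then have "?P (LEAST q. ?P q)" by (rule LeastI)
  moreover have "(LEAST q. ?P q) \<le> q" if "?P q" for q
    using that by (rule Least_le)
  ultimately show ?thesis unfolding responsible_def by blast
qed

text \<open>
  Velocities stay distinct because rephased runners keep velocities that were taken out of the
  starting configuration, while added runners have odd velocities and all the others even ones.
\<close>

lemma configuration_apply_rule:
  assumes data: "rule_data R S A" and adm: "admissible R S N b"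
  shows "configuration (apply_rule R S A N b)"
proof -
  let ?T = "{p \<in> start_config N. fst p \<notin> affected R S b}"
  let ?S = "scaled_runner b (delta N) ` S" and ?A = "scaled_runner b (delta N) ` A"
  have fst_scaled: "fst (scaled_runner b d p) = fst p * b" for d p
    by (simp add: scaled_runner_def split: prod.split)
  have b: "0 < b" "odd b" using adm by (auto simp: admissible_def)
  have evenT: "even (fst p) \<and> 0 < fst p" if "p \<in> ?T" for p
    using that by (auto simp: start_config_def start_velocities_def)
  have evenS: "even (fst p) \<and> 0 < fst p \<and> fst p \<in> affected R S b" if "p \<in> ?S" for p
  proof -
    obtain p' where "p' \<in> S" "p = scaled_runner b (delta N) p'" using \<open>p \<in> ?S\<close> by blast
    then show ?thesis using data b(1) unfolding rule_data_def affected_def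
      by (auto simp: fst_scaled)
  qed
  have oddA: "odd (fst p) \<and> 0 < fst p" if "p \<in> ?A" for p
    using that data b by (auto simp: rule_data_def fst_scaled)
  have injT: "inj_on fst ?T" by (auto simp: inj_on_def start_config_def)
  have inj_scaled: "inj_on fst (scaled_runner b (delta N) ` X)" if "inj_on fst X" for X
  proof (intro inj_onI, elim imageE)
    fix p q p' q' assume *: "fst p = fst q" "p = scaled_runner b (delta N) p'"
      "q = scaled_runner b (delta N) q'" "p' \<in> X" "q' \<in> X"
    then have "fst p' = fst q'" using b(1) by (simp add: fst_scaled)
    with that * show "p = q" by (metis inj_onD)
  qed
  have injS: "inj_on fst ?S" and injA: "inj_on fst ?A"
    using data by (auto simp: rule_data_def intro!: inj_scaled)
  have "inj_on fst (?T \<union> ?S \<union> ?A)"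
    unfolding inj_on_Un
  proof (intro conjI injT injS injA)
    have "fst p \<noteq> fst q" if "p \<in> ?T" "q \<in> ?S" for p q
      using that evenS[of q] by auto
    then show "fst ` (?T - ?S) \<inter> fst ` (?S - ?T) = {}" by blast
    have "fst p \<noteq> fst q" if "p \<in> ?T \<union> ?S" "q \<in> ?A" for p q
      using that evenT[of p] evenS[of p] oddA[of q] by auto
    then show "fst ` (?T \<union> ?S - ?A) \<inter> fst ` (?A - (?T \<union> ?S)) = {}" by blast
  qed
  moreover have "finite (?T \<union> ?S \<union> ?A)"
    using data by (auto simp: rule_data_def start_config_def start_velocities_def)
  ultimately show ?thesis
    unfolding configuration_def apply_rule_def using evenT evenS oddA by blast
qed

text \<open>
  Locality already forces the covering condition of a uniform rule: a time whose responsible runner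
  is unaffected remains covered by that runner.
\<close>

lemma local_ruleI:
  assumes data: "rule_data R S A"
    and covered: "\<And>N b t q. 0 < N \<Longrightarrow> admissible R S N b \<Longrightarrow> q \<in> affected R S b \<Longrightarrow>
      responsible N q t \<Longrightarrow>
      \<exists>p\<in>S \<union> A. dist_nint (position (scaled_runner b (delta N) p) t) \<le> delta N"
  shows "local_rule R S A"
proof -
  have "delta_cover (delta N) (apply_rule R S A N b)" if N: "0 < N" "admissible R S N b" for N b
    unfolding delta_cover_def
  proof (intro conjI allI)
    show "0 < delta N" by (simp add: delta_def add_pos_nonneg)
    show "configuration (apply_rule R S A N b)" using data N(2) by (rule configuration_apply_rule)
    fix t
    obtain q where q: "responsible N q t" using ex_responsible[OF N(1)] by blast
    show "\<exists>p\<in>apply_rule R S A N b. dist_nint (position p t) \<le> delta N"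
    proof (cases "q \<in> affected R S b")
      case True
      then show ?thesis using covered[OF N True q] by (auto simp: apply_rule_def)
    next
      case False
      then have "(q, 0) \<in> apply_rule R S A N b"
        using q by (auto simp: apply_rule_def start_config_def responsible_def)
      moreover have "dist_nint (position (q, 0) t) \<le> delta N"
        using q by (simp add: responsible_def position_def)
      ultimately show ?thesis by blast
    qed
  qed
  then show ?thesis using data covered unfolding local_rule_def uniform_rule_def by blast
qed

text \<open>
  If the nearest integer were even, halving would show that the runner with half the velocity is
  also close to the origin, against minimality; divisibility by \<open>4\<close> keeps the half velocity even.
\<close>

lemma responsible_nearest_int_odd:
  assumes resp: "responsible N q t" and "4 dvd q"
    and near: "\<bar>real q * t - of_int p\<bar> \<le> delta N"
  shows "odd p"
proof
  assume "even p"
  then obtain m where m: "p = 2 * m" by blast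
  obtain k where k: "q = 4 * k" using \<open>4 dvd q\<close> by blast
  have q: "0 < q" "q \<le> 2 * N" using resp by (auto simp: responsible_def start_velocities_def)
  then have "2 * k \<in> start_velocities N" using k by (auto simp: start_velocities_def)
  moreover have "dist_nint (real (2 * k) * t) \<le> delta N"
    by (rule dist_nint_le_of_near_int[of _ m]) (use near k m in simp)
  ultimately have "q \<le> 2 * k" using resp by (auto simp: responsible_def)
  then show False using k q by simp
qed

text \<open>Here \<open>2 y = v x\<close> for the responsible velocity \<open>v\<close>, and the shift \<open>1/2\<close> absorbs the half-integer \<open>p / 2\<close>.\<close>

lemma half_velocity_covers:
  assumes "odd p" "\<bar>2 * y - of_int p\<bar> \<le> d"
  shows "dist_nint (1/2 + 1/2 * d + y) \<le> d"
proof -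
  obtain m where "p = 2 * m + 1" using \<open>odd p\<close> by (rule oddE)
  then show ?thesis using assms(2) by (intro dist_nint_le_of_near_int[of _ "m + 1"]) auto
qed

text \<open>
  Here \<open>y = v x\<close>, and \<open>c\<close> is the factor from \<open>v\<close> to the velocity with shift \<open>- \<delta>\<close>: \<open>c = 1\<close> if
  \<open>v\<close> itself is rephased (\<open>16\<close>, \<open>64\<close>) and \<open>c = 2\<close> if \<open>v\<close> is removed (\<open>8\<close>, \<open>32\<close>). The shift \<open>- \<delta>\<close>
  serves errors \<open>0 \<le> e \<le> \<delta>\<close>, which the factor \<open>2\<close> stretches to exactly the admissible range of length
  \<open>2 \<delta>\<close>; the other runner serves negative errors.
\<close>

lemma sign_of_error_covers:
  fixes c :: int
  assumes "odd p" "\<bar>y - of_int p\<bar> \<le> d" "c \<in> {1, 2}"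
  shows "dist_nint (of_int c * y - d) \<le> d \<or> dist_nint (1/2 + 1/2 * d + 3/2 * y) \<le> d"
proof (cases "of_int p \<le> y")
  case True
  then have "dist_nint (of_int c * y - d) \<le> d"
    using assms by (intro dist_nint_le_of_near_int[of _ "c * p"]) auto
  then show ?thesis ..
next
  case False
  obtain m where "p = 2 * m + 1" using \<open>odd p\<close> by (rule oddE)
  then have "dist_nint (1/2 + 1/2 * d + 3/2 * y) \<le> d"
    using assms(2) False by (intro dist_nint_le_of_near_int[of _ "3 * m + 2"]) auto
  then show ?thesis ..
qed

text \<open>
  Here \<open>4 y = 12 x\<close>. The residue of \<open>p\<close> modulo \<open>4\<close> selects the added runner: for \<open>p \<equiv> 3\<close> the one of
  velocity \<open>3\<close>, and for \<open>p \<equiv> 1\<close> the one of velocity \<open>9\<close>, where \<open>p\<close> is tripled.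
\<close>

lemma quarter_shifts_cover:
  assumes "odd p" "\<bar>4 * y - of_int p\<bar> \<le> d"
  shows "dist_nint (1/4 + y) \<le> d \<or> dist_nint (1/4 + 3 * y) \<le> d"
proof -
  have "p mod 4 = 1 \<or> p mod 4 = 3" using \<open>odd p\<close> by presburger
  then obtain m where "p = 4 * m + 3 \<or> p = 4 * m + 1"
    by (metis mult_div_mod_eq)
  then show ?thesis
  proof
    assume "p = 4 * m + 3"
    then have "dist_nint (1/4 + y) \<le> d"
      using assms(2) by (intro dist_nint_le_of_near_int[of _ "m + 1"]) auto
    then show ?thesis ..
  next
    assume "p = 4 * m + 1"
    then have "dist_nint (1/4 + 3 * y) \<le> d"
      using assms(2) by (intro dist_nint_le_of_near_int[of _ "3 * m + 1"]) auto
    then show ?thesis ..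
  qed
qed

theorem theorem7:
  fixes R :: "nat set" and S A :: "(nat \<times> real \<times> real) set"
  assumes "R = {2^3, 2^5, 3 * 2^6}"
    and "S = {(3 * 2^j, 1/2, 1/2) | j. 2 \<le> j \<and> j \<le> 5} \<union> {(2^4, 0, -1), (2^6, 0, -1)}"
    and "A = {(3, 1/4, 0), (3^2, 1/4, 0)}"
  shows "uniform_rule R S A \<and> local_rule R S A \<and> gain R A = 1"
proof -
  have R: "R = {8, 32, 192}" and A: "A = {(3, 1/4, 0), (9, 1/4, 0)}"
    using assms by simp_all
  have "S = (\<lambda>j::nat. (3 * 2^j, 1/2, 1/2)) ` {2..5} \<union> {(16, 0, -1), (64, 0, -1)}"
    unfolding assms(2) by auto
  also have "{2..5::nat} = {2, 3, 4, 5}" by auto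
  finally have S: "S = {(16, 0, -1), (64, 0, -1),
      (12, 1/2, 1/2), (24, 1/2, 1/2), (48, 1/2, 1/2), (96, 1/2, 1/2)}"
    by simp
  have data: "rule_data R S A"
    by (auto simp: rule_data_def R S A)
  have "local_rule R S A"
  proof (rule local_ruleI[OF data])
    fix N b t q
    assume "q \<in> affected R S b" and resp: "responsible N q t"
    then obtain v where v: "v \<in> {8, 16, 32, 64, 12, 24, 48, 96, 192}" and q: "q = v * b"
      by (auto simp: affected_def R S)
    define x where "x = real b * t"
    obtain p :: int where near: "\<bar>real v * x - of_int p\<bar> \<le> delta N"
      using resp by (auto simp: responsible_def dist_nint_le_iff q x_def mult_ac)
    have "odd p"
      using near v by (intro responsible_nearest_int_odd[OF resp]) (auto simp: q x_def mult_ac)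
    note half = half_velocity_covers[OF this] and sign = sign_of_error_covers[OF this]
      and quarter = quarter_shifts_cover[OF this]
    let ?d = "delta N"
    let ?half_shift = "\<lambda>u. dist_nint (1/2 + 1/2 * ?d + u * x) \<le> ?d"
    let ?minus_shift = "\<lambda>u. dist_nint (u * x - ?d) \<le> ?d"
    let ?quarter_shift = "\<lambda>u. dist_nint (1/4 + u * x) \<le> ?d"
    have "?half_shift 12 \<or> ?half_shift 24 \<or> ?half_shift 48 \<or> ?half_shift 96
        \<or> ?minus_shift 16 \<or> ?minus_shift 64 \<or> ?quarter_shift 3 \<or> ?quarter_shift 9"
    proof -
      consider "v = 8" | "v = 16" | "v = 32" | "v = 64" | "v = 12"
        | "v = 24" | "v = 48" | "v = 96" | "v = 192"
        using v by blast
      then show ?thesis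
      proof cases
        case 1 then show ?thesis using near sign[of "8 * x" ?d 2] by auto
      next
        case 2 then show ?thesis using near sign[of "16 * x" ?d 1] by auto
      next
        case 3 then show ?thesis using near sign[of "32 * x" ?d 2] by auto
      next
        case 4 then show ?thesis using near sign[of "64 * x" ?d 1] by auto
      next
        case 5 then show ?thesis using near quarter[of "3 * x" ?d] by auto
      next
        case 6 then show ?thesis using near half[of "12 * x" ?d] by auto
      next
        case 7 then show ?thesis using near half[of "24 * x" ?d] by auto
      next
        case 8 then show ?thesis using near half[of "48 * x" ?d] by auto
      next
        case 9 then show ?thesis using near half[of "96 * x" ?d] by auto
      qed
    qed
    then show "\<exists>p\<in>S \<union> A. dist_nint (position (scaled_runner b ?d p) t) \<le> ?d"
      by (auto simp: S A position_def scaled_runner_def x_def algebra_simps)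
  qed
  moreover have "gain R A = 1"
    by (simp add: gain_def R A)
  ultimately show ?thesis by (simp add: local_rule_def)
qed

end
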